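(* Let $T$ be a finite tree and let $\sigma$ be a periodic motorized parallel chip-firing game on $T$ with non-empty set of motors $M\subseteq V(T)$. Then for every $v\in V(T)$, every $f\in\{0,1\}$ and every $f$-clump $[a,b]$ of $v$, there exists a motor $m\in M$ such that $[a-D,\,b-D]$ is an $f$-clump of $m$, where $D$ is the distance in $T$ from $m$ to $v$.
   Context: All graphs are finite, undirected, simple and connected; $N(v)$ is the set of neighbors of $v$, $d(v)=\#N(v)$, and $\mathbb{N}=\{0,1,2,\dots\}$. A parallel chip-firing game $\sigma$ on a graph $G$ is a sequence $(\sigma_t)_{t\in\mathbb N}$ of positions, where $\sigma_t(v)$ is the number of chips on $v$ at time $t$, together with firing indicators $F_t(v)\in\{0,1\}$, such that for all $v$ and $t$ $$\sigma_{t+1}(v)=\sigma_t(v)+\sum_{w\in N(v)}F_t(w)-F_t(v)\,d(v).$$ In an ordinary game, all chip counts are natural numbers and $F_t(v)=1$ if $\sigma_t(v)\ge d(v)$ ($v$ fires at $t$), $F_t(v)=0$ if $\sigma_t(v)\le d(v)-1$ ($v$ waits at $t$), for all $v$. In a motorized game there is a non-empty set $M\subseteq V(G)$ of motors: for each motor $m\in M$ the sequence $(F_t(m))_{t\in\mathbb N}$ is an arbitrary predetermined $0/1$ sequence, independent of $\sigma_t(m)$ (and $\sigma_t(m)$ is an integer that may be negative), while each vertex $v\notin M$ has natural-number chip counts and follows the ordinary rule for $F_t(v)$. The motorized game is periodic if there is an integer $p>0$ such that $\sigma_{t+p}=\sigma_t$ and $F_{t+p}(v)=F_t(v)$ for all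 $t\in\mathbb N$ and all vertices $v$. For a periodic game, $F_t(v)$ is extended to all $t\in\mathbb Z$ by periodicity. $[a,b]$ denotes the integer interval $\{a,a+1,\dots,b\}$. For $f\in\{0,1\}$, an interval $[a,b]$ with $a<b$ is an $f$-clump of $v$ if $F_t(v)=f$ for all $t\in[a,b]$. *)

theory Defs
  imports "Graph_Theory.Graph_Theory"
begin

section \<open>Graphs, trees and distance\<close>

text \<open>
  A finite simple undirected graph is a \<^locale>\<open>pair_graph\<close>: the set of arcs is a finite,
  symmetric, irreflexive relation on the finite set of vertices.
\<close>

definition neighbors :: "'a pair_pre_digraph \<Rightarrow> 'a \<Rightarrow> 'a set" where
  "neighbors G v = {w. (v, w) \<in> parcs G}"

definition degree :: "'a pair_pre_digraph \<Rightarrow> 'a \<Rightarrow> nat" where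
  "degree G v = card (neighbors G v)"

text \<open>
  The predicate \<^const>\<open>Digraph_Component.tree\<close> of the library is for directed graphs: it counts
  the closed walk $u, v, u$ along a single undirected edge as a cycle. Cycles of an undirected
  simple graph have at least three edges.
\<close>

definition undirected_tree :: "'a pair_pre_digraph \<Rightarrow> bool" where
  "undirected_tree G \<longleftrightarrow>
     pair_graph G \<and> Digraph_Component.connected (with_proj G) \<and>
     \<not> (\<exists>p. pre_digraph.cycle (with_proj G) p \<and> 3 \<le> length p)"

definition distance :: "'a pair_pre_digraph \<Rightarrow> 'a \<Rightarrow> 'a \<Rightarrow> nat" where
  "distance G u v = (LEAST n. \<exists>p. pre_digraph.awalk (with_proj G) u p v \<and> length p = n)"

lemma distance_eq_\<mu>:
  assumes "pair_graph G" and "u \<rightarrow>\<^sup>*\<^bsub>with_proj G\<^esub> v"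
  shows "ereal (real (distance G u v)) = wf_digraph.\<mu> (with_proj G) (\<lambda>_. 1) u v"
proof -
  interpret pair_graph G by fact
  have cost: "awalk_cost (\<lambda>_. 1) p = real (length p)" for p :: "('a \<times> 'a) list"
    by (induct p) auto
  let ?P = "\<lambda>n. \<exists>p. awalk u p v \<and> length p = n"
  obtain p0 where "awalk u p0 v" using assms(2) by (auto simp: reachable_awalk)
  then have "?P (length p0)" by blast
  then have ex: "?P (distance G u v)"
    unfolding distance_def by (rule LeastI)
  have le: "distance G u v \<le> length p" if "awalk u p v" for p
    unfolding distance_def by (rule Least_le) (use that in blast)
  obtain p where p: "awalk u p v" "length p = distance G u v" using ex by blast
  show ?thesis
  proof (rule antisym)
    show "ereal (real (distance G u v)) \<le> \<mu> (\<lambda>_. 1) u v"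
      unfolding \<mu>_def by (rule INF_greatest) (simp add: cost le)
    show "\<mu> (\<lambda>_. 1) u v \<le> ereal (real (distance G u v))"
      using min_cost_le_walk_cost[OF p(1), of "\<lambda>_. 1"] p(2) by (simp add: cost)
  qed
qed


section \<open>Motorized parallel chip-firing games\<close>

text \<open>
  \<open>\<sigma> t v\<close> is the number of chips on \<open>v\<close> at time \<open>t\<close>, and \<open>F t v\<close> is the firing indicator. The
  firing sequence of a motor is arbitrary, so only the values of \<open>F\<close> off \<open>M\<close> are tied to \<open>\<sigma>\<close>.
  Values of \<open>\<sigma>\<close> and \<open>F\<close> outside the vertex set are irrelevant.
\<close>

locale motorized_game = pair_graph G
  for G :: "'a pair_pre_digraph" +
  fixes M :: "'a set" and \<sigma> :: "nat \<Rightarrow> 'a \<Rightarrow> int" and F :: "nat \<Rightarrow> 'a \<Rightarrow> int"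
  assumes connected: "Digraph_Component.connected (with_proj G)"
    and motors_nonempty: "M \<noteq> {}"
    and motors_subset: "M \<subseteq> pverts G"
    and indicator: "v \<in> pverts G \<Longrightarrow> F t v \<in> {0, 1}"
    and chips_Suc: "v \<in> pverts G \<Longrightarrow>
      \<sigma> (Suc t) v = \<sigma> t v + (\<Sum>w\<in>neighbors G v. F t w) - F t v * int (degree G v)"
    and chips_nonneg: "v \<in> pverts G - M \<Longrightarrow> 0 \<le> \<sigma> t v"
    and firing_rule: "v \<in> pverts G - M \<Longrightarrow>
      F t v = (if int (degree G v) \<le> \<sigma> t v then 1 else 0)"

definition is_period ::
  "'a pair_pre_digraph \<Rightarrow> (nat \<Rightarrow> 'a \<Rightarrow> int) \<Rightarrow> (nat \<Rightarrow> 'a \<Rightarrow> int) \<Rightarrow> nat \<Rightarrow> bool" where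
  "is_period G \<sigma> F p \<longleftrightarrow>
     0 < p \<and> (\<forall>t. \<forall>v\<in>pverts G. \<sigma> (t + p) v = \<sigma> t v \<and> F (t + p) v = F t v)"

definition periodic ::
  "'a pair_pre_digraph \<Rightarrow> (nat \<Rightarrow> 'a \<Rightarrow> int) \<Rightarrow> (nat \<Rightarrow> 'a \<Rightarrow> int) \<Rightarrow> bool" where
  "periodic G \<sigma> F \<longleftrightarrow> (\<exists>p. is_period G \<sigma> F p)"

text \<open>
  The extension of the firing indicators of a periodic game to all integer times. The least period
  is only a convenient choice: by \<open>firing_ext_eq\<close> below every period gives the same result.
\<close>

definition firing_ext ::
  "'a pair_pre_digraph \<Rightarrow> (nat \<Rightarrow> 'a \<Rightarrow> int) \<Rightarrow> (nat \<Rightarrow> 'a \<Rightarrow> int) \<Rightarrow> int \<Rightarrow> 'a \<Rightarrow> int" where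
  "firing_ext G \<sigma> F t v = F (nat (t mod int (LEAST p. is_period G \<sigma> F p))) v"

lemma is_period_add_mult:
  assumes "is_period G \<sigma> F p" and "v \<in> pverts G"
  shows "F (t + k * p) v = F t v"
proof (induct k)
  case (Suc k)
  have "F (t + Suc k * p) v = F ((t + k * p) + p) v" by (simp add: algebra_simps)
  also have "\<dots> = F (t + k * p) v" using assms unfolding is_period_def by blast
  finally show ?case using Suc by simp
qed simp

lemma is_period_cong:
  assumes "is_period G \<sigma> F p" and "v \<in> pverts G" and "int s mod int p = int t mod int p"
  shows "F s v = F t v"
proof -
  have "F n v = F (n mod p) v" for n
    using is_period_add_mult[OF assms(1,2), of "n mod p" "n div p"] by simp
  moreover have "s mod p = t mod p" using assms(3) by (metis of_nat_eq_iff of_nat_mod)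
  ultimately show ?thesis by metis
qed

lemma firing_ext_eq:
  assumes "is_period G \<sigma> F p" and v: "v \<in> pverts G"
  shows "firing_ext G \<sigma> F t v = F (nat (t mod int p)) v"
proof -
  define q where "q = (LEAST p. is_period G \<sigma> F p)"
  have q: "is_period G \<sigma> F q" unfolding q_def by (rule LeastI) (rule assms(1))
  have pos: "0 < int p" "0 < int q" using assms(1) q by (auto simp: is_period_def)
  define r where "r = t mod (int p * int q)"
  have r: "0 \<le> r" unfolding r_def using pos by simp
  have "F (nat (t mod int q)) v = F (nat r) v"
    by (rule is_period_cong[OF q v]) (use r pos in \<open>simp add: r_def mod_mod_cancel\<close>)
  moreover have "F (nat (t mod int p)) v = F (nat r) v"
    by (rule is_period_cong[OF assms(1) v]) (use r pos in \<open>simp add: r_def mod_mod_cancel\<close>)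
  ultimately show ?thesis by (simp add: firing_ext_def q_def)
qed

lemma firing_ext_of_nat:
  assumes "periodic G \<sigma> F" and "v \<in> pverts G"
  shows "firing_ext G \<sigma> F (int t) v = F t v"
proof -
  obtain p where p: "is_period G \<sigma> F p" using assms(1) by (auto simp: periodic_def)
  show ?thesis unfolding firing_ext_eq[OF p assms(2)]
    by (rule is_period_cong[OF p assms(2)]) (use p in \<open>simp add: is_period_def\<close>)
qed

definition clump :: "(int \<Rightarrow> 'a \<Rightarrow> int) \<Rightarrow> int \<Rightarrow> 'a \<Rightarrow> int \<Rightarrow> int \<Rightarrow> bool" where
  "clump F f v a b \<longleftrightarrow> a < b \<and> (\<forall>t\<in>{a..b}. F t v = f)"

end

theory Submission
  imports Defs
begin

text \<open>
  Let $v$ be a vertex that is not a motor, and let $[c + 1, b]$ be a clump of $v$ that cannot be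
  extended to the left. If every neighbor of $v$ deviated from $f$ at some time in $[c, b - 1]$,
  then, as $v$ itself deviates there only at $c$, the chips of $v$ at the times $c$ and $b$ would
  contradict the firing rule. Hence some neighbor $w$ has the clump $[c, b - 1]$. If we came to $v$
  from a neighbor $u$ with a clump extended to the left in the same way, then $u$ deviates at a
  time in $[c, b - 1]$, so $w \neq u$. The clump is thus traced back along a walk that
  does not backtrack; in a tree the distance from its start grows by one in every step, so the walk
  ends, and it can only end at a motor. A vertex whose clump can be extended to the left forever is
  constant, and then all vertices are constant by a maximum principle.
\<close>

section \<open>Distances in trees\<close>

context pair_graph
begin

lemma neighbors_subset: "neighbors G v \<subseteq> pverts G"
  by (auto simp: neighbors_def dest: in_arcsD2)

lemma finite_neighbors: "finite (neighbors G v)"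
  using finite_subset[OF neighbors_subset pair_finite_verts] .

lemma arc_sym: "(u, v) \<in> parcs G \<Longrightarrow> (v, u) \<in> parcs G"
  using pair_sym_arcs by (auto simp: symmetric_def elim: symE)

lemma connected_awalk:
  assumes "Digraph_Component.connected (with_proj G)" "u \<in> pverts G" "v \<in> pverts G"
  obtains p where "awalk u p v"
proof -
  have "strongly_connected (with_proj G)"
    using symmetric_connected_imp_strongly_connected pair_sym_arcs assms(1) by blast
  then have "u \<rightarrow>\<^sup>*\<^bsub>with_proj G\<^esub> v"
    using assms(2,3) by (auto simp: strongly_connected_def)
  then show ?thesis
    using that by (auto simp: reachable_awalk)
qed

lemma distance_le: "awalk u p v \<Longrightarrow> distance G u v \<le> length p"
  unfolding distance_def by (rule Least_le) blast

lemma shortest_awalk: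
  assumes "awalk u p v"
  obtains q where "awalk u q v" "length q = distance G u v"
  using LeastI[of "\<lambda>n. \<exists>q. awalk u q v \<and> length q = n" "length p"] assms
  unfolding distance_def by blast

lemma distance_self: "v \<in> pverts G \<Longrightarrow> distance G v v = 0"
  using distance_le[of v "[]" v] by (simp add: awalk_Nil_iff)

lemma distance_neighbor:
  assumes "(u, v) \<in> parcs G"
  shows "distance G u v = 1"
proof -
  have walk: "awalk u [(u, v)] v"
    using assms by (simp add: awalk_simps in_arcsD2)
  obtain q where "awalk u q v" "length q = distance G u v"
    using shortest_awalk[OF walk] .
  moreover have "u \<noteq> v"
    using pair_no_loops[OF assms] by simp
  ultimately have "distance G u v \<noteq> 0"
    by (cases q) (auto simp: awalk_Nil_iff)
  then show ?thesis
    using distance_le[OF walk] by simp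
qed

text \<open>Bounds the distances along a traced walk, so that the induction measure of
  \<open>trace_clump\<close> strictly decreases.\<close>

lemma distance_less_card:
  assumes "awalk u p v"
  shows "distance G u v < card (pverts G)"
  using distance_le length_apath_less apath_awalk_to_apath[OF assms]
  by (meson apath_def le_less_trans)

lemma distance_less_on_shortest_awalk:
  assumes "awalk u q v" "length q = distance G u v" "x \<in> set (awalk_verts u q)" "x \<noteq> u"
  shows "distance G x v < distance G u v"
proof -
  obtain r s where "q = r @ s" "awalk u r x" "awalk x s v"
    using awalk_decomp[OF assms(1,3)] by blast
  moreover from this have "r \<noteq> []"
    using assms(4) by (auto simp: awalk_Nil_iff)
  ultimately show ?thesis
    using distance_le[of x s v] assms(2) by (cases r) auto
qed

text \<open>Such a walk, shortened to a path, would close up through \<open>x\<close> to a cycle. As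
  \<open>u\<close> and \<open>w\<close> differ, the path has an arc, so the cycle has at least
  three.\<close>

lemma no_awalk_avoiding_common_neighbor:
  assumes "undirected_tree G" "(x, u) \<in> parcs G" "(x, w) \<in> parcs G" "u \<noteq> w"
    and "awalk u p w"
  shows "x \<in> set (awalk_verts u p)"
proof (rule ccontr)
  assume x: "x \<notin> set (awalk_verts u p)"
  define q where "q = awalk_to_apath p"
  have q: "apath u q w"
    unfolding q_def by (rule apath_awalk_to_apath) (rule assms(5))
  then have walk: "awalk u q w" and distinct: "distinct (awalk_verts u q)"
    by (auto simp: apath_def)
  have "set q \<subseteq> set p"
    unfolding q_def by (rule awalk_to_apath_subset) (rule assms(5))
  then have "set (awalk_verts u q) \<subseteq> set (awalk_verts u p)"
    using set_awalk_verts[OF walk] set_awalk_verts[OF assms(5)] by auto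
  then have x': "x \<notin> set (awalk_verts u q)"
    using x by blast
  have "q \<noteq> []"
    using walk assms(4) by (auto simp: awalk_Nil_iff)
  let ?c = "(x, u) # q @ [(w, x)]"
  have "awalk x ?c x"
    using walk assms(2,3) arc_sym[OF assms(3)] by (auto simp: awalk_simps in_arcsD1)
  moreover have "distinct (tl (awalk_verts x ?c))"
  proof -
    have "awalk u (q @ [(w, x)]) x"
      using walk arc_sym[OF assms(3)] by (auto simp: awalk_simps in_arcsD2)
    from awalk_verts_append[OF this] have "awalk_verts u (q @ [(w, x)]) = awalk_verts u q @ [x]"
      by simp
    then show ?thesis
      using distinct x' by simp
  qed
  ultimately have "cycle ?c"
    unfolding cycle_def by blast
  moreover have "3 \<le> length ?c"
    using \<open>q \<noteq> []\<close> by (cases q) auto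
  ultimately show False
    using assms(1) unfolding undirected_tree_def by blast
qed

text \<open>A walk that arrived at \<open>x\<close> by moving away from \<open>v\<close> and does
  not turn back moves away again. Going from \<open>u\<close> to \<open>v\<close> and on to
  \<open>w\<close> along shortest walks must meet \<open>x\<close>. The first half is too short for
  that, so \<open>x\<close> lies on the shortest walk between \<open>w\<close> and
  \<open>v\<close>.\<close>

lemma tree_distance_step:
  assumes tree: "undirected_tree G"
    and arcs: "(x, u) \<in> parcs G" "(x, w) \<in> parcs G" "u \<noteq> w"
    and v: "v \<in> pverts G" and dist: "distance G x v = distance G u v + 1"
  shows "distance G w v = distance G x v + 1"
proof -
  have conn: "Digraph_Component.connected (with_proj G)"
    using tree by (simp add: undirected_tree_def)
  have verts: "x \<in> pverts G" "u \<in> pverts G" "w \<in> pverts G"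
    using arcs by (auto dest: in_arcsD1 in_arcsD2)
  obtain p where p: "awalk u p v" "length p = distance G u v"
    using connected_awalk[OF conn verts(2) v] shortest_awalk by metis
  obtain q where q: "awalk w q v" "length q = distance G w v"
    using connected_awalk[OF conn verts(3) v] shortest_awalk by metis
  obtain r where r: "awalk x r v" "length r = distance G x v"
    using connected_awalk[OF conn verts(1) v] shortest_awalk by metis
  have ne: "x \<noteq> u" "x \<noteq> w"
    using pair_no_loops[OF arcs(1)] pair_no_loops[OF arcs(2)] by auto
  have "x \<notin> set (awalk_verts u p)"
    using distance_less_on_shortest_awalk[OF p _ ne(1)] dist by auto
  moreover have rev: "awalk v (rev_path q) w"
    using q(1) by simp
  have "x \<in> set (awalk_verts u (p @ rev_path q))"
    using no_awalk_avoiding_common_neighbor[OF tree arcs] awalk_appendI[OF p(1) rev] by blast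
  ultimately have "x \<in> set (awalk_verts w q)"
    using set_awalk_verts_append[OF p(1) rev] awalk_verts_rev_path[OF q(1)] by auto
  then have "distance G x v < distance G w v"
    by (rule distance_less_on_shortest_awalk[OF q _ ne(2)])
  moreover have "awalk w ((w, x) # r) v"
    using r(1) arc_sym[OF arcs(2)] by (simp add: awalk_simps)
  then have "distance G w v \<le> distance G x v + 1"
    using distance_le[of w "(w, x) # r" v] r(2) by simp
  ultimately show ?thesis
    by simp
qed

end

section \<open>Clumps of periodic motorized games\<close>

locale periodic_motorized_game = motorized_game G M \<sigma> F
  for G :: "'a pair_pre_digraph" and M \<sigma> F +
  fixes p :: nat
  assumes period: "is_period G \<sigma> F p"
begin

section \<open>Extension of the game to integer times\<close>

abbreviation E :: "int \<Rightarrow> 'a \<Rightarrow> int" where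
  "E \<equiv> firing_ext G \<sigma> F"

definition S :: "int \<Rightarrow> 'a \<Rightarrow> int" where
  "S t v = \<sigma> (nat (t mod int p)) v"

lemma p_pos: "0 < p"
  using period by (simp add: is_period_def)

lemma E_eq: "v \<in> pverts G \<Longrightarrow> E t v = F (nat (t mod int p)) v"
  by (rule firing_ext_eq[OF period])

lemma E_indicator: "v \<in> pverts G \<Longrightarrow> E t v \<in> {0, 1}"
  using indicator by (simp add: E_eq)

lemma E_periodic: "v \<in> pverts G \<Longrightarrow> E (t + k * int p) v = E t v"
  by (simp add: E_eq)

lemma E_firing_rule:
  "v \<in> pverts G - M \<Longrightarrow> E t v = (if int (degree G v) \<le> S t v then 1 else 0)"
  using firing_rule by (simp add: E_eq S_def)

lemma S_Suc:
  assumes "v \<in> pverts G"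
  shows "S (t + 1) v = S t v + (\<Sum>w\<in>neighbors G v. E t w) - E t v * int (degree G v)"
proof -
  define n where "n = nat (t mod int p)"
  have n: "t mod int p = int n" "n < p"
    using p_pos by (auto simp: n_def nat_less_iff)
  have "(t + 1) mod int p = int (Suc n) mod int p"
    by (metis n(1) mod_add_left_eq of_nat_Suc add.commute)
  then have "S (t + 1) v = \<sigma> (Suc n mod p) v"
    unfolding S_def by (metis nat_int of_nat_mod)
  also have "\<dots> = \<sigma> (Suc n) v"
  \<comment> \<open>At the end of a period the residue wraps around to 0, where periodicity supplies
    the chip count of time \<open>p\<close>.\<close>
  proof (cases "Suc n = p")
    case True
    have "\<sigma> (0 + p) v = \<sigma> 0 v"
      using period assms unfolding is_period_def by blast
    then show ?thesis
      using True by simp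
  qed (use n(2) in simp)
  also have "\<dots> = \<sigma> n v + (\<Sum>w\<in>neighbors G v. F n w) - F n v * int (degree G v)"
    by (rule chips_Suc[OF assms])
  also have "(\<Sum>w\<in>neighbors G v. F n w) = (\<Sum>w\<in>neighbors G v. E t w)"
    using subsetD[OF neighbors_subset[of v]] by (intro sum.cong refl) (simp add: E_eq n_def)
  finally show ?thesis
    using assms by (simp add: E_eq S_def n_def)
qed

section \<open>Deviation counts and chip balance, for firing and waiting alike\<close>

definition deviations :: "int \<Rightarrow> int \<Rightarrow> nat \<Rightarrow> 'a \<Rightarrow> int" where
  "deviations f a n v = (\<Sum>i<n. of_bool (E (a + int i) v \<noteq> f))"

lemma deviations_nonneg: "0 \<le> deviations f a n v"
  unfolding deviations_def by (rule sum_nonneg) simp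

lemma deviations_eq_0_iff: "deviations f a n v = 0 \<longleftrightarrow> (\<forall>i<n. E (a + int i) v = f)"
  unfolding deviations_def by (subst sum_nonneg_eq_0_iff) auto

text \<open>The factor $1 - 2 f$ is a sign: the balance for $f = 1$ is that of the waiting times.\<close>

lemma chip_balance:
  assumes v: "v \<in> pverts G" and f: "f \<in> {0, 1}"
  shows "(1 - 2 * f) * (S (a + int n) v - S a v) =
    (\<Sum>w\<in>neighbors G v. deviations f a n w) - int (degree G v) * deviations f a n v"
proof (induction n)
  case 0
  show ?case by (simp add: deviations_def)
next
  case (Suc n)
  let ?t = "a + int n"
  \<comment> \<open>For 0/1 values the deviation indicator is affine in \<open>E\<close>, so the
    sums over neighbors become linear.\<close>
  have dev: "of_bool (E t w \<noteq> f) = (1 - 2 * f) * (E t w - f)" if "w \<in> pverts G" for t w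
    using E_indicator[OF that, of t] f by auto
  have "(\<Sum>w\<in>neighbors G v. deviations f a (Suc n) w) =
      (\<Sum>w\<in>neighbors G v. deviations f a n w + (1 - 2 * f) * (E ?t w - f))"
    using subsetD[OF neighbors_subset[of v]]
    by (intro sum.cong refl) (simp add: deviations_def dev del: of_bool_eq_iff)
  also have "\<dots> = (\<Sum>w\<in>neighbors G v. deviations f a n w) +
      (1 - 2 * f) * ((\<Sum>w\<in>neighbors G v. E ?t w) - int (degree G v) * f)"
    by (simp add: sum.distrib sum_subtractf degree_def flip: sum_distrib_left)
  finally have nbrs: "(\<Sum>w\<in>neighbors G v. deviations f a (Suc n) w) = \<dots>" .
  have self: "deviations f a (Suc n) v = deviations f a n v + (1 - 2 * f) * (E ?t v - f)"
    by (simp add: deviations_def dev v)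
  have chips: "S (a + int (Suc n)) v =
      S ?t v + (\<Sum>w\<in>neighbors G v. E ?t w) - E ?t v * int (degree G v)"
    using S_Suc[OF v, of ?t] by (simp add: ac_simps)
  show ?case
    unfolding nbrs self chips using Suc.IH by (simp add: algebra_simps)
qed

text \<open>Over a full period the chips of \<open>v\<close> return and \<open>v\<close> never
  deviates, so the balance makes the nonnegative deviation counts of its neighbors sum to 0.\<close>

lemma constant_neighbor:
  assumes v: "v \<in> pverts G" and f: "f \<in> {0, 1}" and const: "\<And>t. E t v = f"
    and w: "w \<in> neighbors G v"
  shows "E t w = f"
proof -
  have "S (0 + int p) v = S 0 v"
    by (simp add: S_def)
  moreover have "deviations f 0 p v = 0"
    by (simp add: deviations_eq_0_iff const)
  ultimately have "(\<Sum>w\<in>neighbors G v. deviations f 0 p w) = 0"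
    using chip_balance[OF v f, of 0 p] by simp
  then have "deviations f 0 p w = 0"
    using w sum_nonneg_eq_0_iff[OF finite_neighbors, of v "deviations f 0 p"] deviations_nonneg
    by blast
  then have *: "E (int i) w = f" if "i < p" for i
    using that by (simp add: deviations_eq_0_iff)
  have "E t w = E (t mod int p) w"
    using w subsetD[OF neighbors_subset] by (simp add: E_eq)
  then show ?thesis
    using *[of "nat (t mod int p)"] p_pos by (simp add: nat_less_iff)
qed

text \<open>The chip balance holds at motors as well, so constancy spreads along every walk.\<close>

lemma constant_vertex:
  assumes v: "v \<in> pverts G" and f: "f \<in> {0, 1}" and const: "\<And>t. E t v = f"
    and u: "u \<in> pverts G"
  shows "E t u = f"
proof -
  obtain q where "awalk v q u"
    using connected_awalk[OF connected v u] .
  then show ?thesis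
    using v const
  proof (induction q arbitrary: v t)
    case Nil
    then show ?case by (simp add: awalk_Nil_iff)
  next
    case (Cons e q)
    then have "snd e \<in> neighbors G v"
      by (auto simp: awalk_Cons_iff neighbors_def)
    then have "E t (snd e) = f" for t
      using constant_neighbor[OF Cons.prems(2) f Cons.prems(3)] by blast
    moreover have "awalk (snd e) q u" "snd e \<in> pverts G"
      using Cons.prems(1) by (auto simp: awalk_Cons_iff intro: arc_snd_in_verts)
    ultimately show ?case
      using Cons.IH by blast
  qed
qed

section \<open>Tracing clumps back to a motor\<close>

lemma left_maximal_extension:
  assumes v: "v \<in> pverts G" and s: "E s v \<noteq> f" and clump: "\<forall>t\<in>{a..b}. E t v = f"
  obtains c where "c < a" "E c v \<noteq> f" "\<forall>t\<in>{c + 1..b}. E t v = f"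
proof -
  \<comment> \<open>The search runs backwards from \<open>a - 1\<close>, so the least solution is
    the last deviation before \<open>a\<close>.\<close>
  let ?P = "\<lambda>n. E (a - 1 - int n) v \<noteq> f"
  \<comment> \<open>Going back this many periods moves the deviation at \<open>s\<close> to the left
    of \<open>a\<close>.\<close>
  define s' where "s' = s + - (\<bar>s - a\<bar> + 1) * int p"
  have "\<bar>s - a\<bar> + 1 \<le> (\<bar>s - a\<bar> + 1) * int p"
    using p_pos mult_left_mono[of 1 "int p" "\<bar>s - a\<bar> + 1"] by simp
  then have "s' < a"
    unfolding s'_def mult_minus_left by linarith
  moreover have "E s' v \<noteq> f"
    using s E_periodic[OF v, of s "- (\<bar>s - a\<bar> + 1)"] by (simp add: s'_def)
  ultimately have ex: "?P (nat (a - 1 - s'))"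
    by simp
  define k where "k = Least ?P"
  have k: "?P k"
    unfolding k_def by (rule LeastI) (rule ex)
  have "E t v = f" if t: "a - 1 - int k + 1 \<le> t" "t \<le> b" for t
  proof (cases "a \<le> t")
    case False
    then have "nat (a - 1 - t) < Least ?P"
      unfolding k_def[symmetric] using t by simp
    from not_less_Least[OF this] show ?thesis
      using False by simp
  qed (use clump t in auto)
  then have "\<forall>t\<in>{a - 1 - int k + 1..b}. E t v = f"
    unfolding Ball_def atLeastAtMost_iff by blast
  then show ?thesis
    by (rule that[OF _ k, rotated]) linarith
qed

lemma neighbor_clump:
  assumes v: "v \<in> pverts G - M" and f: "f \<in> {0, 1}" and "c < b"
    and c: "E c v \<noteq> f" and clump: "\<forall>t\<in>{c + 1..b}. E t v = f"
  shows "\<exists>w\<in>neighbors G v. \<forall>t\<in>{c..b - 1}. E t w = f"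
proof (rule ccontr)
  assume contr: "\<not> ?thesis"
  \<comment> \<open>\<open>Suc n\<close> is the length of the window from \<open>c\<close> to
    \<open>b - 1\<close>.\<close>
  define n where "n = nat (b - c - 1)"
  have b: "b = c + int (Suc n)"
    using \<open>c < b\<close> by (simp add: n_def)
  have "1 \<le> deviations f c (Suc n) w" if "w \<in> neighbors G v" for w
  proof -
    have "\<not> (\<forall>t\<in>{c..b - 1}. E t w = f)"
      using contr that by blast
    then obtain t where t: "t \<in> {c..b - 1}" "E t w \<noteq> f"
      by blast
    then have "nat (t - c) < Suc n" "E (c + int (nat (t - c))) w \<noteq> f"
      using b by auto
    then have "deviations f c (Suc n) w \<noteq> 0"
      unfolding deviations_eq_0_iff by blast
    then show ?thesis
      using deviations_nonneg[of f c "Suc n" w] by simp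
  qed
  then have "int (degree G v) \<le> (\<Sum>w\<in>neighbors G v. deviations f c (Suc n) w)"
    using sum_mono[of "neighbors G v" "\<lambda>_. 1" "deviations f c (Suc n)"]
    by (simp add: degree_def)
  \<comment> \<open>Within the window \<open>v\<close> deviates only at its first time
    \<open>c\<close>.\<close>
  moreover have "deviations f c (Suc n) v = 1"
    unfolding deviations_def using c clump b by (subst sum.lessThan_Suc_shift) auto
  ultimately have "0 \<le> (1 - 2 * f) * (S b v - S c v)"
    using chip_balance[of v f c "Suc n"] v f b by simp
  moreover have "E b v = f"
    using clump \<open>c < b\<close> by simp
  \<comment> \<open>For \<open>f = 0\<close>, \<open>v\<close> fires at \<open>c\<close> and waits
    at \<open>b\<close>, so its chip count has dropped below the degree; for \<open>f = 1\<close> it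
    has risen to at least the degree. Both contradict the sign of the difference.\<close>
  ultimately show False
    using c f E_firing_rule[OF v, of b] E_firing_rule[OF v, of c] by (auto split: if_splits)
qed

text \<open>Invariant of the backward walk: \<open>u\<close> is the previous vertex, one step closer
  to \<open>v\<close>, and it deviates at \<open>c\<close>. The run of \<open>x\<close> from
  \<open>c\<close> on contains the shifted clump; starting it at \<open>c\<close> is what rules out
  a return to \<open>u\<close>.\<close>

lemma trace_clump:
  assumes tree: "undirected_tree G" and v: "v \<in> pverts G" and f: "f \<in> {0, 1}" and "a < b"
    and nonconst: "\<And>x. x \<in> pverts G \<Longrightarrow> \<exists>t. E t x \<noteq> f"
    and "(x, u) \<in> parcs G" "distance G x v = distance G u v + 1"
    and "c \<le> a - int (distance G x v)" "E c u \<noteq> f"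
    and "\<forall>t\<in>{c..b - int (distance G x v)}. E t x = f"
  shows "\<exists>m\<in>M. clump E f m (a - int (distance G m v)) (b - int (distance G m v))"
  using assms(6-)
proof (induction "card (pverts G) - distance G x v" arbitrary: x u c rule: less_induct)
  case less
  let ?d = "int (distance G x v)"
  have x: "x \<in> pverts G"
    using less.prems(1) by (rule in_arcsD1)
  show ?case
  proof (cases "x \<in> M")
    case True
    then show ?thesis
      using \<open>a < b\<close> less.prems(3,5) by (intro bexI[of _ x]) (auto simp: clump_def)
  next
    case False
    obtain s where "E s x \<noteq> f"
      using nonconst[OF x] by blast
    then obtain c' where c': "c' < c" "E c' x \<noteq> f" "\<forall>t\<in>{c' + 1..b - ?d}. E t x = f"
      using left_maximal_extension[OF x _ less.prems(5)] by blast
    have "x \<in> pverts G - M" "c' < b - ?d"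
      using x False c'(1) less.prems(3) \<open>a < b\<close> by auto
    from neighbor_clump[OF this(1) f this(2) c'(2,3)]
    obtain w where w: "(x, w) \<in> parcs G" "\<forall>t\<in>{c'..b - ?d - 1}. E t w = f"
      by (auto simp: neighbors_def)
    \<comment> \<open>By \<open>c' < c\<close> and \<open>a < b\<close>, the time \<open>c\<close>
      lies in the new window, where \<open>w\<close> agrees with \<open>f\<close> while
      \<open>u\<close> deviates.\<close>
    have "u \<noteq> w"
      using w(2) less.prems(3,4) c'(1) \<open>a < b\<close> by fastforce
    with tree_distance_step[OF tree less.prems(1) w(1) _ v less.prems(2)]
    have dist: "distance G w v = distance G x v + 1"
      by blast
    obtain q where "awalk x q v"
      using connected_awalk[OF connected x v] .
    then have "card (pverts G) - distance G w v < card (pverts G) - distance G x v"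
      using distance_less_card dist by fastforce
    then show ?thesis
      by (rule less.hyps[OF _ arc_sym[OF w(1)] dist _ c'(2)])
        (use dist c'(1) less.prems(3) w(2) in \<open>auto simp: algebra_simps\<close>)
  qed
qed

lemma motor_clump:
  assumes tree: "undirected_tree G" and v: "v \<in> pverts G" and f: "f \<in> {0, 1}"
    and clump: "clump E f v a b"
  shows "\<exists>m\<in>M. clump E f m (a - int (distance G m v)) (b - int (distance G m v))"
proof -
  have "a < b" and ab: "\<forall>t\<in>{a..b}. E t v = f"
    using clump by (auto simp: clump_def)
  show ?thesis
  \<comment> \<open>If one vertex is constantly \<open>f\<close>, so is every motor, and any of them
    will do.\<close>
  proof (cases "\<exists>x\<in>pverts G. \<forall>t. E t x = f")
    case True
    then obtain x where "x \<in> pverts G" "\<And>t. E t x = f"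
      by blast
    moreover obtain m where "m \<in> M" "m \<in> pverts G"
      using motors_nonempty motors_subset by blast
    ultimately have "E t m = f" for t
      using constant_vertex[OF _ f] by blast
    then show ?thesis
      using \<open>m \<in> M\<close> \<open>a < b\<close> by (intro bexI[of _ m]) (simp_all add: clump_def)
  next
    case nonconst: False
    show ?thesis
    proof (cases "v \<in> M")
      case True
      then show ?thesis
        using clump by (intro bexI[of _ v]) (simp_all add: distance_self v)
    next
      case False
      obtain s where "E s v \<noteq> f"
        using nonconst v by blast
      then obtain c where c: "c < a" "E c v \<noteq> f" "\<forall>t\<in>{c + 1..b}. E t v = f"
        using left_maximal_extension[OF v _ ab] by blast
      have "v \<in> pverts G - M" "c < b"
        using v False c(1) \<open>a < b\<close> by auto
      from neighbor_clump[OF this(1) f this(2) c(2,3)]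
      obtain w where w: "(v, w) \<in> parcs G" "\<forall>t\<in>{c..b - 1}. E t w = f"
        by (auto simp: neighbors_def)
      \<comment> \<open>The tracing starts at \<open>w\<close>, at distance 1, with \<open>v\<close>
        as the previous vertex and \<open>c\<close> as its deviation.\<close>
      show ?thesis
        by (rule trace_clump[OF tree v f \<open>a < b\<close> _ arc_sym[OF w(1)] _ _ c(2)])
          (use nonconst c(1) w(2) in
            \<open>auto simp: distance_neighbor[OF arc_sym[OF w(1)]] distance_self v\<close>)
    qed
  qed
qed

end

theorem theorem3p2:
  fixes T :: "'a pair_pre_digraph" and M :: "'a set"
    and \<sigma> :: "nat \<Rightarrow> 'a \<Rightarrow> int" and F :: "nat \<Rightarrow> 'a \<Rightarrow> int"
  assumes "undirected_tree T"
    and "motorized_game T M \<sigma> F"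
    and "periodic T \<sigma> F"
  shows "\<forall>v\<in>pverts T. \<forall>f\<in>{0, 1}. \<forall>a b.
    clump (firing_ext T \<sigma> F) f v a b \<longrightarrow>
      (\<exists>m\<in>M. clump (firing_ext T \<sigma> F) f m
         (a - int (distance T m v)) (b - int (distance T m v)))"
proof -
  obtain p where "is_period T \<sigma> F p"
    using assms(3) by (auto simp: periodic_def)
  with assms(2) interpret periodic_motorized_game T M \<sigma> F p
    by (simp add: periodic_motorized_game_def periodic_motorized_game_axioms_def)
  show ?thesis
    using motor_clump[OF assms(1)] by blast
qed

end
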